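(* Let $G=(V,E,w)$ be a finite vertex-weighted graph with nonnegative vertex weights and maximum degree $\Delta$. For any $\varepsilon\in(0,0.1]$ and integer $k\in\mathbb{Z}_+$, if $k\ge\max\left\{\frac{\chi(G)}{\varepsilon},2\Delta\right\}$ and $\max_{v\in V}w_v\le \varepsilon\frac{w(V)}{k}$, then there exists a $(1+7\varepsilon)$-EQ1 $k$-coloring of $G$, where $\chi(G)$ denotes the chromatic number of $G$.
   Context: For $S\subseteq V$, $w(S)=\sum_{v\in S}w_v$. A $k$-coloring of $G$ is a partition $(C_1,\dots,C_k)$ of $V$ into $k$ (possibly empty) sets, each of which is an independent set of $G$. For $\alpha\ge 1$, a coloring $(C_1,\dots,C_k)$ is $\alpha$-EQ1 if for every $i,j\in[k]$ with $C_i\neq\emptyset$ there exists a vertex $\bar v\in C_i$ such that $w(C_i\setminus\{\bar v\})\le \alpha\, w(C_j)$. *)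

theory Defs
  imports Complex_Main "HOL-Library.Disjoint_Sets" "Graph_Theory.Digraph"
begin

text \<open>
  Finite simple undirected graphs are given by the locale \<^locale>\<open>graph\<close>: finite symmetric
  digraphs without loops and multiple arcs. Each undirected edge is thus a pair of opposite arcs,
  and the degree of a vertex is its out-degree.
\<close>

definition max_degree :: "('a, 'b) pre_digraph \<Rightarrow> nat" where
  \<comment> \<open>inserting 0 only matters for the graph without vertices\<close>
  "max_degree G = Max (insert 0 (out_degree G ` verts G))"

definition independent_set :: "('a, 'b) pre_digraph \<Rightarrow> 'a set \<Rightarrow> bool" where
  "independent_set G S \<longleftrightarrow>
     S \<subseteq> verts G \<and> (\<forall>u\<in>S. \<forall>v\<in>S. (u, v) \<notin> arcs_ends G)"

definition k_coloring :: "('a, 'b) pre_digraph \<Rightarrow> nat \<Rightarrow> (nat \<Rightarrow> 'a set) \<Rightarrow> bool" where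
  "k_coloring G k C \<longleftrightarrow>
     disjoint_family_on C {1..k} \<and> (\<Union>i\<in>{1..k}. C i) = verts G \<and>
     (\<forall>i\<in>{1..k}. independent_set G (C i))"

definition chromatic_number :: "('a, 'b) pre_digraph \<Rightarrow> nat" where
  "chromatic_number G = (LEAST k. \<exists>C. k_coloring G k C)"

definition EQ1 :: "('a \<Rightarrow> real) \<Rightarrow> real \<Rightarrow> nat \<Rightarrow> (nat \<Rightarrow> 'a set) \<Rightarrow> bool" where
  "EQ1 w \<alpha> k C \<longleftrightarrow>
     (\<forall>i\<in>{1..k}. \<forall>j\<in>{1..k}. C i \<noteq> {} \<longrightarrow>
        (\<exists>v\<in>C i. sum w (C i - {v}) \<le> \<alpha> * sum w (C j)))"

lemma ex_k_coloring:
  assumes "graph G"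
  shows "\<exists>k C. k_coloring G k C"
proof -
  interpret graph G by fact
  obtain f where f: "bij_betw f {1..card (verts G)} (verts G)"
    using ex_bij_betw_nat_finite_1[OF finite_verts] by blast
  have "independent_set G {f i}" if "i \<in> {1..card (verts G)}" for i
    using bij_betwE[OF f] that adj_not_same unfolding independent_set_def by blast
  moreover have "disjoint_family_on (\<lambda>i. {f i}) {1..card (verts G)}"
    using bij_betw_imp_inj_on[OF f] unfolding disjoint_family_on_def inj_on_def by blast
  moreover have "(\<Union>i\<in>{1..card (verts G)}. {f i}) = verts G"
    using bij_betw_imp_surj_on[OF f] by blast
  ultimately have "k_coloring G (card (verts G)) (\<lambda>i. {f i})"
    unfolding k_coloring_def by blast
  then show ?thesis by blast
qed

end

theory Submission
  imports Defs
begin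

text \<open>
  Let \<open>\<mu> = w(V)/k\<close> and \<open>t = \<mu>(1 - \<epsilon>)/(1 + \<epsilon>)\<close>. As long as fewer than \<open>k\<close> pieces of weight between
  \<open>t\<close> and \<open>t + \<epsilon>\<mu>\<close> have been cut out of an optimal coloring, the remaining weight exceeds
  \<open>\<chi>(G) t\<close>, so some color class still contains weight \<open>t\<close> and another piece can be cut from it.
  The vertices outside the \<open>k\<close> pieces are then added one at a time. At least \<open>k/2\<close> classes contain
  no neighbor of the vertex, and since every class weighs at least \<open>t\<close>, one of these weighs at most
  \<open>2\<mu> - t\<close>. All final weights lie between \<open>t\<close> and \<open>2\<mu> - t + \<epsilon>\<mu> \<le> (1 + 7\<epsilon>) t\<close>.
\<close>

text \<open>Drop elements one by one while the rest still weighs at least \<open>t\<close>. Once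
  dropping \<open>x\<close> would leave less than \<open>t\<close>, the current set exceeds
  \<open>t\<close> by less than \<open>w x \<le> m\<close>.\<close>

lemma exists_subset_sum_between:
  fixes w :: "'a \<Rightarrow> real"
  assumes "finite A" and "\<And>v. v \<in> A \<Longrightarrow> w v \<le> m" and "0 \<le> t" and "0 \<le> m" and "t \<le> sum w A"
  shows "\<exists>B\<subseteq>A. t \<le> sum w B \<and> sum w B \<le> t + m"
  using assms
proof (induction A rule: finite_induct)
  case empty
  then show ?case by auto
next
  case (insert x A)
  show ?case
  proof (cases "t \<le> sum w A")
    case True
    then show ?thesis using insert by (metis insertCI subset_insertI2)
  next
    case False
    have "w x \<le> m" using insert.prems by blast
    with False insert.hyps have "sum w (insert x A) \<le> t + m" by simp
    with insert.prems show ?thesis by blast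
  qed
qed

lemma independent_set_subset:
  "independent_set G S \<Longrightarrow> T \<subseteq> S \<Longrightarrow> independent_set G T"
  unfolding independent_set_def by blast

text \<open>Greedy cutting by induction on \<open>n\<close>. The hypothesis \<open>total\<close>
  reads \<open>k * (t + m) + c * t \<le> w(V)\<close>: even \<open>k\<close> pieces of largest
  allowed weight leave \<open>c * t\<close>, enough for the pigeonhole principle over the
  \<open>c\<close> color classes.\<close>

lemma exists_balanced_independent_family:
  fixes w :: "'a \<Rightarrow> real"
  assumes fin: "finite (verts G)"
    and col: "k_coloring G c C"
    and le_m: "\<And>v. v \<in> verts G \<Longrightarrow> w v \<le> m" and t: "0 \<le> t" and m: "0 \<le> m"
    and total: "real (k + c) * t + real k * m \<le> sum w (verts G)"
    and "n \<le> k"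
  shows "\<exists>D. disjoint_family_on D {1..n} \<and>
    (\<forall>i\<in>{1..n}. independent_set G (D i) \<and> t \<le> sum w (D i) \<and> sum w (D i) \<le> t + m)"
  using \<open>n \<le> k\<close>
proof (induction n)
  case 0
  show ?case by (simp add: disjoint_family_on_def)
next
  case (Suc n)
  then obtain D where dis: "disjoint_family_on D {1..n}"
    and D: "\<And>i. i \<in> {1..n} \<Longrightarrow> independent_set G (D i) \<and> t \<le> sum w (D i) \<and> sum w (D i) \<le> t + m"
    by auto
  define R where "R = verts G - (\<Union>i\<in>{1..n}. D i)"
  have sub: "(\<Union>i\<in>{1..n}. D i) \<subseteq> verts G"
    using D unfolding independent_set_def by blast
  have finD: "finite (D i)" if "i \<in> {1..n}" for i
    using sub that finite_subset[OF _ fin] by blast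
  have "\<exists>B. B \<subseteq> R \<and> independent_set G B \<and> t \<le> sum w B \<and> sum w B \<le> t + m"
  \<comment> \<open>For \<open>t = 0\<close> the empty set is a valid piece. For
    \<open>t > 0\<close> the leftover weight is strictly above \<open>c * t\<close>, which also
    makes the pigeonhole step work when \<open>c = 0\<close>.\<close>
  proof (cases "t = 0")
    case True
    with m show ?thesis by (intro exI[of _ "{}"]) (simp add: independent_set_def)
  next
    case False
    with t have t0: "0 < t" by simp
    have "sum w (\<Union>i\<in>{1..n}. D i) = (\<Sum>i\<in>{1..n}. sum w (D i))"
      using dis finD
      by (intro sum.UNION_disjoint) (auto simp: disjoint_family_on_def)
    also have "\<dots> \<le> (\<Sum>i\<in>{1..n}. t + m)"
      using D by (intro sum_mono) blast
    finally have "sum w (\<Union>i\<in>{1..n}. D i) \<le> real n * (t + m)" by simp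
    then have "sum w (verts G) - real n * (t + m) \<le> sum w R"
      using sum_diff[OF fin sub, of w] by (simp add: R_def)
    \<comment> \<open>The budget of the piece still to be cut, \<open>t + m > 0\<close>, is unspent;
      this makes the next inequality strict.\<close>
    moreover have "real (Suc n) * (t + m) \<le> real k * (t + m)"
      using Suc.prems t m by (intro mult_right_mono) auto
    ultimately have R: "real c * t < sum w R"
      using total t0 m by (simp add: algebra_simps)
    have "sum w R = sum w (\<Union>j\<in>{1..c}. R \<inter> C j)"
      using col by (intro arg_cong[of _ _ "sum w"]) (auto simp: R_def k_coloring_def)
    also have "\<dots> = (\<Sum>j\<in>{1..c}. sum w (R \<inter> C j))"
      using col fin
      by (intro sum.UNION_disjoint) (auto simp: disjoint_family_on_def k_coloring_def R_def)
    finally have eq: "sum w R = (\<Sum>j\<in>{1..c}. sum w (R \<inter> C j))" .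
    have "\<exists>j\<in>{1..c}. t \<le> sum w (R \<inter> C j)"
    proof (rule ccontr)
      assume "\<not> ?thesis"
      then have "(\<Sum>j\<in>{1..c}. sum w (R \<inter> C j)) \<le> (\<Sum>j\<in>{1..c}. t)"
        by (intro sum_mono) force
      with R eq show False by simp
    qed
    then obtain j where j: "j \<in> {1..c}" "t \<le> sum w (R \<inter> C j)" by blast
    have "\<exists>B\<subseteq>R \<inter> C j. t \<le> sum w B \<and> sum w B \<le> t + m"
      using j fin le_m t m by (intro exists_subset_sum_between) (auto simp: R_def)
    moreover have "independent_set G (C j)" using col j by (simp add: k_coloring_def)
    ultimately show ?thesis using independent_set_subset by blast
  qed
  then obtain B where B: "B \<subseteq> R" "independent_set G B" "t \<le> sum w B" "sum w B \<le> t + m" by blast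
  have set: "{1..Suc n} = insert (Suc n) {1..n}" by auto
  have "disjoint_family_on (D(Suc n := B)) {1..Suc n}"
    using dis B(1) unfolding set R_def disjoint_family_on_def by auto
  moreover have "\<forall>i\<in>{1..Suc n}. independent_set G ((D(Suc n := B)) i) \<and>
      t \<le> sum w ((D(Suc n := B)) i) \<and> sum w ((D(Suc n := B)) i) \<le> t + m"
    using D B by (auto simp: set)
  ultimately show ?case by blast
qed

text \<open>Choosing one neighbor of \<open>v\<close> in each such class is injective, because the
  classes are disjoint, so there are at most as many such classes as neighbors.\<close>

lemma (in graph) card_classes_meeting_neighbors_le_max_degree:
  assumes "disjoint_family_on C I" and "v \<in> verts G"
  shows "card {i \<in> I. \<exists>u\<in>C i. (v, u) \<in> arcs_ends G} \<le> max_degree G"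
proof -
  let ?B = "{i \<in> I. \<exists>u\<in>C i. (v, u) \<in> arcs_ends G}"
  let ?N = "head G ` out_arcs G v"
  have "\<forall>i\<in>?B. \<exists>u. u \<in> C i \<and> (v, u) \<in> arcs_ends G" by blast
  from bchoice[OF this] obtain f
    where f: "\<And>i. i \<in> ?B \<Longrightarrow> f i \<in> C i \<and> (v, f i) \<in> arcs_ends G" by blast
  have "inj_on f ?B"
  proof (rule inj_onI)
    fix i j assume "i \<in> ?B" "j \<in> ?B" "f i = f j"
    then have "f i \<in> C i \<inter> C j" using f[of i] f[of j] by simp
    with \<open>i \<in> ?B\<close> \<open>j \<in> ?B\<close> show "i = j"
      using assms(1) unfolding disjoint_family_on_def by blast
  qed
  moreover have "f ` ?B \<subseteq> ?N"
  proof
    fix u assume "u \<in> f ` ?B"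
    then have "(v, u) \<in> arcs_ends G" using f by blast
    then show "u \<in> ?N" by (force simp: arcs_ends_conv)
  qed
  ultimately have "card ?B \<le> card ?N"
    by (intro card_inj_on_le) auto
  also have "\<dots> \<le> out_degree G v"
    unfolding out_degree_def by (intro card_image_le finite_out_arcs)
  also have "\<dots> \<le> max_degree G"
    unfolding max_degree_def using assms(2) by (intro Max_ge) auto
  finally show ?thesis .
qed

text \<open>Each vertex goes into a class without neighbors of it that weighs at most
  \<open>L\<close>; the upper bound \<open>L + m\<close> thus survives. Such a class exists:
  otherwise at least half of the classes weigh more than \<open>L\<close> and the others at least
  \<open>t\<close>, which together exceeds \<open>k * (L + t) / 2 \<ge> w(V)\<close>.\<close>

lemma (in graph) extend_balanced_independent_family:
  fixes w :: "'a \<Rightarrow> real"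
  assumes nonneg: "\<And>v. v \<in> verts G \<Longrightarrow> 0 \<le> w v" and le_m: "\<And>v. v \<in> verts G \<Longrightarrow> w v \<le> m"
    and "1 \<le> k" and deg: "2 * max_degree G \<le> k"
    and "t \<le> L" and total: "2 * sum w (verts G) \<le> real k * (L + t)"
    and dis: "disjoint_family_on C {1..k}"
    and C: "\<And>i. i \<in> {1..k} \<Longrightarrow> independent_set G (C i) \<and> t \<le> sum w (C i) \<and> sum w (C i) \<le> L + m"
    and S: "S \<subseteq> verts G - (\<Union>i\<in>{1..k}. C i)"
  shows "\<exists>D. disjoint_family_on D {1..k} \<and> (\<Union>i\<in>{1..k}. D i) = (\<Union>i\<in>{1..k}. C i) \<union> S \<and>
    (\<forall>i\<in>{1..k}. independent_set G (D i) \<and> t \<le> sum w (D i) \<and> sum w (D i) \<le> L + m)"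
proof -
  have "finite S" using S by (auto intro: finite_subset[OF _ finite_verts])
  then show ?thesis using S
  proof (induction S rule: finite_induct)
    case empty
    show ?case using dis C by (intro exI[of _ C]) simp
  next
    case (insert v S)
    then obtain D where dis: "disjoint_family_on D {1..k}"
      and un: "(\<Union>i\<in>{1..k}. D i) = (\<Union>i\<in>{1..k}. C i) \<union> S"
      and D: "\<And>i. i \<in> {1..k} \<Longrightarrow> independent_set G (D i) \<and> t \<le> sum w (D i) \<and> sum w (D i) \<le> L + m"
      by auto
    have v: "v \<in> verts G" "v \<notin> (\<Union>i\<in>{1..k}. D i)" using insert un by auto
    have sub: "(\<Union>i\<in>{1..k}. D i) \<subseteq> verts G"
      using D unfolding independent_set_def by blast
    have finD: "finite (D i)" if "i \<in> {1..k}" for i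
      using sub that finite_subset[OF _ finite_verts] by blast
    \<comment> \<open>The classes that cannot receive \<open>v\<close>; the degree bound limits them
      to half of all.\<close>
    define B where "B = {i \<in> {1..k}. \<exists>u\<in>D i. (v, u) \<in> arcs_ends G}"
    have B: "B \<subseteq> {1..k}" "finite B" by (auto simp: B_def)
    have "card B \<le> max_degree G"
      unfolding B_def by (rule card_classes_meeting_neighbors_le_max_degree[OF dis v(1)])
    with deg have cB: "2 * card B \<le> k" by simp
    have "\<exists>j\<in>{1..k} - B. sum w (D j) \<le> L"
    proof (rule ccontr)
      assume "\<not> ?thesis"
      then have heavy: "\<And>j. j \<in> {1..k} - B \<Longrightarrow> L < sum w (D j)" by force
      have cA: "card ({1..k} - B) = k - card B" using B by (simp add: card_Diff_subset)
      \<comment> \<open>At least one class is free of neighbors, as the strict comparison of sums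
        below requires.\<close>
      then have "0 < card ({1..k} - B)" using cB \<open>1 \<le> k\<close> by linarith
      then have ne: "{1..k} - B \<noteq> {}" by (metis card.empty less_irrefl)
      have "real k * (L + t) \<le> 2 * (real (k - card B) * L + real (card B) * t)"
      proof -
        \<comment> \<open>This product is exactly the right side minus the left side of the
          claim.\<close>
        have "0 \<le> (real k - 2 * real (card B)) * (L - t)"
          using cB \<open>t \<le> L\<close> by (intro mult_nonneg_nonneg) auto
        moreover have "real (k - card B) = real k - real (card B)" using cB by simp
        ultimately show ?thesis by (simp add: algebra_simps)
      qed
      also have "real (k - card B) * L + real (card B) * t = (\<Sum>i\<in>{1..k} - B. L) + (\<Sum>i\<in>B. t)"
        using cA by simp
      also have "\<dots> < (\<Sum>i\<in>{1..k} - B. sum w (D i)) + (\<Sum>i\<in>B. sum w (D i))"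
        using D B heavy ne by (intro add_less_le_mono sum_strict_mono sum_mono) auto
      also have "\<dots> = (\<Sum>i\<in>{1..k}. sum w (D i))"
        using B by (simp add: sum.subset_diff)
      also have "\<dots> = sum w (\<Union>i\<in>{1..k}. D i)"
        using dis finD by (intro sum.UNION_disjoint[symmetric]) (auto simp: disjoint_family_on_def)
      also have "\<dots> \<le> sum w (verts G)"
        using sub nonneg by (intro sum_mono2) auto
      finally show False using total by simp
    qed
    then obtain j where j: "j \<in> {1..k}" "j \<notin> B" "sum w (D j) \<le> L" by blast
    let ?D = "D(j := insert v (D j))"
    \<comment> \<open>\<open>independent_set\<close> tests ordered pairs, so both directions are
      required; symmetry of the arcs gives the second.\<close>
    have no_arc: "(v, u) \<notin> arcs_ends G \<and> (u, v) \<notin> arcs_ends G" if "u \<in> D j" for u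
      using j that arcs_ends_symmetric[OF sym_arcs] unfolding B_def by blast
    have "independent_set G (insert v (D j))"
      using D[OF j(1)] v no_arc adj_not_same unfolding independent_set_def by blast
    moreover have "sum w (insert v (D j)) = w v + sum w (D j)"
      using v j finD by (intro sum.insert) auto
    ultimately have "\<forall>i\<in>{1..k}. independent_set G (?D i) \<and> t \<le> sum w (?D i) \<and> sum w (?D i) \<le> L + m"
      using D nonneg[OF v(1)] le_m[OF v(1)] j by (auto intro: add_increasing)
    moreover have "disjoint_family_on ?D {1..k}"
      using dis v j unfolding disjoint_family_on_def by auto
    moreover have "(\<Union>i\<in>{1..k}. ?D i) = (\<Union>i\<in>{1..k}. C i) \<union> insert v S"
    proof -
      have "(\<Union>i\<in>{1..k}. ?D i) = insert v (\<Union>i\<in>{1..k}. D i)"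
        using j by (auto split: if_splits)
      with un show ?thesis by simp
    qed
    ultimately show ?case by blast
  qed
qed

theorem theorem6:
  fixes G :: "('a, 'b) pre_digraph" and w :: "'a \<Rightarrow> real" and \<epsilon> :: real and k :: nat
  assumes "graph G"
    and "\<And>v. v \<in> verts G \<Longrightarrow> w v \<ge> 0"
    and "0 < \<epsilon>" and "\<epsilon> \<le> 0.1"
    and "k \<ge> 1"
    and "real k \<ge> max (real (chromatic_number G) / \<epsilon>) (2 * real (max_degree G))"
    and "\<And>v. v \<in> verts G \<Longrightarrow> w v \<le> \<epsilon> * (sum w (verts G) / real k)"
  shows "\<exists>C. k_coloring G k C \<and> EQ1 w (1 + 7 * \<epsilon>) k C"
proof -
  interpret graph G by fact
  define c where "c = chromatic_number G"
  define \<mu> where "\<mu> = sum w (verts G) / real k"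
  \<comment> \<open>Chosen so that \<open>(1 + \<epsilon>) * t + m = \<mu>\<close>. With
    \<open>c \<le> \<epsilon> * k\<close> this yields the weight budget for cutting \<open>k\<close>
    pieces.\<close>
  define t where "t = \<mu> * (1 - \<epsilon>) / (1 + \<epsilon>)"
  define m where "m = \<epsilon> * \<mu>"
  \<comment> \<open>The threshold for which \<open>k * (L + t) = 2 * w(V)\<close>.\<close>
  define L where "L = 2 * \<mu> - t"
  have W: "sum w (verts G) = real k * \<mu>" using \<open>k \<ge> 1\<close> by (simp add: \<mu>_def)
  have \<mu>: "0 \<le> \<mu>" using assms(2) by (simp add: \<mu>_def sum_nonneg)
  have t: "0 \<le> t" using \<mu> assms(3,4) by (simp add: t_def)
  have m: "0 \<le> m" using \<mu> assms(3) by (simp add: m_def)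
  have t_eq: "(1 + \<epsilon>) * t = (1 - \<epsilon>) * \<mu>" using assms(3) by (simp add: t_def)
  have "t \<le> \<mu>"
  proof -
    have "(1 + \<epsilon>) * t \<le> (1 + \<epsilon>) * \<mu>"
      unfolding t_eq using \<mu> assms(3) by (intro mult_right_mono) auto
    then show ?thesis using assms(3) by simp
  qed
  have deg: "2 * max_degree G \<le> k" using assms(6) by simp
  have c: "real c \<le> \<epsilon> * real k"
    using assms(3,6) by (simp add: c_def field_simps)
  obtain C where C: "k_coloring G c C"
    using LeastI_ex[OF ex_k_coloring[OF \<open>graph G\<close>]] unfolding c_def chromatic_number_def by blast
  have "real (k + c) * t + real k * m \<le> (real k * (1 + \<epsilon>)) * t + real k * m"
    using c t by (intro add_right_mono mult_right_mono) (auto simp: algebra_simps)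
  also have "\<dots> = real k * ((1 + \<epsilon>) * t + m)" by (simp add: algebra_simps)
  also have "\<dots> = sum w (verts G)"
    unfolding t_eq W m_def by (simp add: algebra_simps)
  finally obtain D where D: "disjoint_family_on D {1..k}"
    "\<And>i. i \<in> {1..k} \<Longrightarrow> independent_set G (D i) \<and> t \<le> sum w (D i) \<and> sum w (D i) \<le> t + m"
    using exists_balanced_independent_family[OF finite_verts C _ t m _ order_refl, of w k] assms(7)
    unfolding m_def \<mu>_def by blast
  have tL: "t \<le> L" using \<open>t \<le> \<mu>\<close> by (simp add: L_def)
  \<comment> \<open>All uncovered vertices are distributed at once, so the extended family covers
    the whole graph.\<close>
  have "\<exists>E. disjoint_family_on E {1..k} \<and>
      (\<Union>i\<in>{1..k}. E i) = (\<Union>i\<in>{1..k}. D i) \<union> (verts G - (\<Union>i\<in>{1..k}. D i)) \<and>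
      (\<forall>i\<in>{1..k}. independent_set G (E i) \<and> t \<le> sum w (E i) \<and> sum w (E i) \<le> L + m)"
  proof (rule extend_balanced_independent_family)
    show "2 * sum w (verts G) \<le> real k * (L + t)" by (simp add: W L_def)
    show "w v \<le> m" if "v \<in> verts G" for v using assms(7)[OF that] by (simp add: m_def \<mu>_def)
    show "independent_set G (D i) \<and> t \<le> sum w (D i) \<and> sum w (D i) \<le> L + m" if "i \<in> {1..k}" for i
      using D(2)[OF that] tL by simp
  qed (use assms(2,5) deg tL D(1) in auto)
  moreover have "(\<Union>i\<in>{1..k}. D i) \<subseteq> verts G"
    using D(2) unfolding independent_set_def by blast
  ultimately obtain E where E: "disjoint_family_on E {1..k}" "(\<Union>i\<in>{1..k}. E i) = verts G"
    "\<And>i. i \<in> {1..k} \<Longrightarrow> independent_set G (E i) \<and> t \<le> sum w (E i) \<and> sum w (E i) \<le> L + m"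
    by (auto simp: Un_Diff_cancel sup.absorb2)
  have Lm: "L + m \<le> (1 + 7 * \<epsilon>) * t"
  proof -
    \<comment> \<open>The right side minus the left side is
      \<open>2 * \<epsilon> * (1 - 4 * \<epsilon>)\<close>, nonnegative since \<epsilon> \<le> 0.1.
      As \<open>L + m = (2 + \<epsilon>) * \<mu> - t\<close>, the goal amounts to
      \<open>(2 + \<epsilon>) * \<mu> \<le> (2 + 7 * \<epsilon>) * t\<close>.\<close>
    have "(2 + \<epsilon>) * (1 + \<epsilon>) \<le> (2 + 7 * \<epsilon>) * (1 - \<epsilon>)"
      using mult_right_mono[OF assms(4), of \<epsilon>] assms(3) by (simp add: algebra_simps)
    then have "(2 + \<epsilon>) * (1 + \<epsilon>) * \<mu> \<le> (2 + 7 * \<epsilon>) * (1 - \<epsilon>) * \<mu>"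
      using \<mu> by (rule mult_right_mono)
    also have "\<dots> = (2 + 7 * \<epsilon>) * ((1 + \<epsilon>) * t)" by (simp add: t_eq)
    finally have "(1 + \<epsilon>) * ((2 + \<epsilon>) * \<mu>) \<le> (1 + \<epsilon>) * ((2 + 7 * \<epsilon>) * t)"
      by (simp add: mult_ac)
    then have "(2 + \<epsilon>) * \<mu> \<le> (2 + 7 * \<epsilon>) * t" using assms(3) by simp
    then show ?thesis by (simp add: L_def m_def algebra_simps)
  qed
  have "EQ1 w (1 + 7 * \<epsilon>) k E"
    unfolding EQ1_def
  proof (intro ballI impI)
    fix i j assume i: "i \<in> {1..k}" and j: "j \<in> {1..k}" and "E i \<noteq> {}"
    \<comment> \<open>Any element serves as witness, since the bound is proved for the weight of the
      whole class.\<close>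
    then obtain v where v: "v \<in> E i" by blast
    have sub: "E i \<subseteq> verts G" using E(3)[OF i] by (simp add: independent_set_def)
    then have "sum w (E i - {v}) \<le> sum w (E i)"
      using assms(2) finite_subset[OF _ finite_verts] by (intro sum_mono2) auto
    also have "\<dots> \<le> (1 + 7 * \<epsilon>) * t" using E(3)[OF i] Lm by simp
    also have "\<dots> \<le> (1 + 7 * \<epsilon>) * sum w (E j)"
      using E(3)[OF j] assms(3) by (intro mult_left_mono) auto
    finally show "\<exists>v\<in>E i. sum w (E i - {v}) \<le> (1 + 7 * \<epsilon>) * sum w (E j)" using v by blast
  qed
  moreover have "k_coloring G k E" using E unfolding k_coloring_def by blast
  ultimately show ?thesis by blast
qed

end
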